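(* Let $g>0$ and $K\in\mathbb{N}$, and consider the skew-symmetric stochastic Galerkin shallow water system for the unknown $\widehat U=(\widehat h^\top,\widehat q^\top)^\top$, $\widehat h(x,t),\widehat q(x,t)\in\mathbb{R}^K$, with given time-independent bottom coefficient vector $\widehat B(x)\in\mathbb{R}^K$: $$\widehat h_t+\widehat q_x=0,$$ $$\widehat q_t+\big(\mathcal P(\widehat q)\widehat u\big)_x+g\,\mathcal P(\widehat h)(\widehat h+\widehat B)_x-\tfrac12\mathcal P(\widehat h_t)\widehat u-\tfrac12\mathcal P(\widehat q_x)\widehat u=0,$$ where $\widehat u:=\mathcal P(\widehat h)^{-1}\widehat q$. If the matrix $\mathcal P(\widehat h)$ is strictly positive definite at every point $(x,t)$ of the space-time domain, then this system is hyperbolic.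
   Context: Let $\rho$ be a probability density on $\mathbb{R}^d$ with finite polynomial moments of all orders, and let $\phi_1\equiv 1,\phi_2,\phi_3,\dots$ be real $d$-variate polynomials orthonormal with respect to $\langle f,g\rangle_\rho=\int_{\mathbb{R}^d}f(s)g(s)\rho(s)\,ds$. For $\widehat z=(\widehat z_1,\dots,\widehat z_K)^\top\in\mathbb{R}^K$ define the linear map $$\mathcal P(\widehat z):=\sum_{k=1}^K\widehat z_k\mathcal M_k\in\mathbb{R}^{K\times K},\qquad (\mathcal M_k)_{l,m}:=\langle\phi_k,\phi_l\phi_m\rangle_\rho,\quad 1\le l,m\le K.$$ The matrix $\mathcal P(\widehat z)$ is symmetric. Hyperbolicity: a first-order system of PDEs for $U$ is called hyperbolic if, by left multiplication by an invertible matrix $L(U)$ that depends only on the state variable and involves no space or time derivatives, it can be written in the quasilinear form $U_t+A(U)U_x=S(U)$, where $A(U)$ is diagonalizable with real eigenvalues. Here the source term $S$ contains no derivatives of $U$, and may involve the given data $\widehat B_x$. *)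

theory Defs
  imports "HOL-Analysis.Analysis"
begin

definition prob_density :: "(real^'d \<Rightarrow> real) \<Rightarrow> bool" where
  "prob_density \<rho> \<longleftrightarrow>
     (\<forall>s. 0 \<le> \<rho> s) \<and> has_bochner_integral lborel \<rho> 1"

definition finite_moments :: "(real^'d \<Rightarrow> real) \<Rightarrow> bool" where
  "finite_moments \<rho> \<longleftrightarrow>
     (\<forall>\<alpha> :: 'd \<Rightarrow> nat. integrable lborel (\<lambda>s. (\<Prod>i\<in>UNIV. (s $ i) ^ \<alpha> i) * \<rho> s))"

definition inner_rho :: "(real^'d \<Rightarrow> real) \<Rightarrow> (real^'d \<Rightarrow> real) \<Rightarrow> (real^'d \<Rightarrow> real) \<Rightarrow> real" where
  "inner_rho \<rho> f g = (\<integral>s. f s * g s * \<rho> s \<partial>lborel)"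

definition triple_mat ::
    "(real^'d \<Rightarrow> real) \<Rightarrow> ('k::finite \<Rightarrow> real^'d \<Rightarrow> real) \<Rightarrow> 'k \<Rightarrow> real^'k^'k" where
  "triple_mat \<rho> \<psi> k = (\<chi> l m. inner_rho \<rho> (\<psi> k) (\<lambda>s. \<psi> l s * \<psi> m s))"

definition galerkin_mat ::
    "(real^'d \<Rightarrow> real) \<Rightarrow> ('k::finite \<Rightarrow> real^'d \<Rightarrow> real) \<Rightarrow> real^'k \<Rightarrow> real^'k^'k" where
  "galerkin_mat \<rho> \<psi> z = (\<Sum>k\<in>UNIV. (z $ k) *\<^sub>R triple_mat \<rho> \<psi> k)"

(* Symmetry is not part of this predicate; it is only applied to values of galerkin_mat,
   which are symmetric matrices. *)
definition pos_definite :: "real^'n^'n \<Rightarrow> bool" where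
  "pos_definite A \<longleftrightarrow> (\<forall>v. v \<noteq> 0 \<longrightarrow> 0 < v \<bullet> (A *v v))"

(* Diagonalizable over the reals, i.e. diagonalizable with real eigenvalues
   (the diagonal entries of \<Lambda>). *)
definition real_diagonalizable :: "real^'n^'n \<Rightarrow> bool" where
  "real_diagonalizable A \<longleftrightarrow>
     (\<exists>V \<Lambda> :: real^'n^'n. invertible V \<and> (\<forall>i j. i \<noteq> j \<longrightarrow> \<Lambda> $ i $ j = 0) \<and>
        A = V ** \<Lambda> ** matrix_inv V)"

definition partial_x :: "(real \<times> real \<Rightarrow> 'a::real_normed_vector) \<Rightarrow> real \<times> real \<Rightarrow> 'a" where
  "partial_x F = (\<lambda>(x, t). vector_derivative (\<lambda>y. F (y, t)) (at x))"

definition partial_t :: "(real \<times> real \<Rightarrow> 'a::real_normed_vector) \<Rightarrow> real \<times> real \<Rightarrow> 'a" where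
  "partial_t F = (\<lambda>(x, t). vector_derivative (\<lambda>s. F (x, s)) (at t))"

(* A first-order system for a state field U (of points (x,t)) with given data B (of x) is encoded
   by its residual operator R: the system is the equation R B U p = 0. It is hyperbolic on the set
   G of states if one choice of L, A, S, depending on the state value only (S also on the value of
   B_x), brings R into quasilinear form simultaneously for all differentiable fields that take
   values in G on an open space-time domain D. The fields are not required to be solutions. *)
definition hyperbolic_system ::
    "((real \<Rightarrow> real^'m) \<Rightarrow> (real \<times> real \<Rightarrow> real^'n) \<Rightarrow> real \<times> real \<Rightarrow> real^'n)
       \<Rightarrow> (real^'n) set \<Rightarrow> bool" where
  "hyperbolic_system R G \<longleftrightarrow>
     (\<exists>(L :: real^'n \<Rightarrow> real^'n^'n) (A :: real^'n \<Rightarrow> real^'n^'n) (S :: real^'n \<Rightarrow> real^'m \<Rightarrow> real^'n).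
        (\<forall>w\<in>G. invertible (L w) \<and> real_diagonalizable (A w)) \<and>
        (\<forall>D U B. open D \<longrightarrow> (\<forall>p\<in>D. U differentiable (at p)) \<longrightarrow>
           (\<forall>p\<in>D. B differentiable (at (fst p))) \<longrightarrow> (\<forall>p\<in>D. U p \<in> G) \<longrightarrow>
           (\<forall>p\<in>D. L (U p) *v R B U p =
              partial_t U p + A (U p) *v partial_x U p
                - S (U p) (vector_derivative B (at (fst p))))))"

definition vec_stack :: "real^'k \<Rightarrow> real^'k \<Rightarrow> real^('k + 'k)" where
  "vec_stack a b = (\<chi> i. case i of Inl k \<Rightarrow> a $ k | Inr k \<Rightarrow> b $ k)"

definition h_part :: "real^('k + 'k) \<Rightarrow> real^'k" where
  "h_part w = (\<chi> k. w $ Inl k)"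

definition q_part :: "real^('k + 'k) \<Rightarrow> real^'k" where
  "q_part w = (\<chi> k. w $ Inr k)"

definition sg_swe ::
    "real \<Rightarrow> (real^'k \<Rightarrow> real^'k^'k) \<Rightarrow> (real \<Rightarrow> real^'k) \<Rightarrow> (real \<times> real \<Rightarrow> real^('k + 'k))
       \<Rightarrow> real \<times> real \<Rightarrow> real^('k + 'k)" where
  "sg_swe g P B U p =
     (let h = (\<lambda>p. h_part (U p));
          q = (\<lambda>p. q_part (U p));
          u = (\<lambda>p. matrix_inv (P (h p)) *v q p)
      in vec_stack
           (partial_t h p + partial_x q p)
           (partial_t q p + partial_x (\<lambda>p. P (q p) *v u p) p
             + g *\<^sub>R (P (h p) *v partial_x (\<lambda>p. h p + B (fst p)) p)
             - (1/2) *\<^sub>R (P (partial_t h p) *v u p)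
             - (1/2) *\<^sub>R (P (partial_x q p) *v u p)))"

end

theory Submission
  imports Defs
begin

text \<open>
  Write \<open>P\<close> for the Galerkin product, \<open>H = P h\<close> and \<open>u = H\<^sup>-\<^sup>1 q\<close>. Full symmetry of the triple
  products makes \<open>P a\<close> a symmetric matrix with \<open>P a b = P b a\<close>. Hence adding \<open>P u / 2\<close> times the
  first equation to the second one cancels the two skew-symmetric terms, and eliminating \<open>u\<^sub>x\<close> by
  \<open>P h\<^sub>x u + H u\<^sub>x = q\<^sub>x\<close> leaves the quasilinear system with block matrix
  \<open>A = (0, 1; g H - P q H\<^sup>-\<^sup>1 P u, P u + P q H\<^sup>-\<^sup>1)\<close>. In the variables \<open>(h, q - P u h)\<close> it becomes
  \<open>(P u, 1; g H, P q H\<^sup>-\<^sup>1)\<close>, which is self-adjoint for the positive definite form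
  \<open>diag (g, H\<^sup>-\<^sup>1)\<close>; so \<open>A\<close> has a basis of real eigenvectors.
\<close>

section \<open>Matrix inverses, and diagonalization of maps self-adjoint for a positive definite
  form\<close>

lemma
  fixes A :: "'a::semiring_1^'n^'m"
  assumes "invertible A"
  shows mul_matrix_inv: "A ** matrix_inv A = mat 1"
    and matrix_inv_mul: "matrix_inv A ** A = mat 1"
  using someI_ex[OF assms[unfolded invertible_def]]
  by (simp_all add: matrix_inv_def)

text \<open>A general form \<open>b\<close> replaces the Euclidean inner product because the system
  matrix is self-adjoint only for a state-dependent form. The invariant subspace \<open>W\<close>
  allows the search for an eigenvector to be repeated inside a complement.\<close>

lemma bilinear_selfadjoint_eigenvector:
  fixes b :: "'a::euclidean_space \<Rightarrow> 'a \<Rightarrow> real"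
  assumes bil: "bilinear b"
    and sym: "\<And>v w. b v w = b w v"
    and pos: "\<And>v. v \<noteq> 0 \<Longrightarrow> 0 < b v v"
    and lin: "linear f"
    and self: "\<And>v w. b (f v) w = b v (f w)"
    and W: "subspace W" "W \<noteq> {0}"
    and inv: "\<And>v. v \<in> W \<Longrightarrow> f v \<in> W"
  shows "\<exists>x\<in>W. x \<noteq> 0 \<and> (\<exists>l. f x = l *\<^sub>R x)"
proof -
  interpret bb: bounded_bilinear b
    using bil by (simp add: bilinear_conv_bounded_bilinear)
  interpret bounded_linear f
    using lin by (simp add: linear_linear)
  \<comment> \<open>A maximizer of the Rayleigh quotient is an eigenvector: there the positive semidefinite form
    \<open>c\<close> below vanishes, so \<open>c x\<close> vanishes on all of \<open>W\<close>.\<close>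
  define R where "R v = b (f v) v / b v v" for v
  have "compact (sphere 0 1 \<inter> W)"
    using W(1) by (intro compact_Int_closed closed_subspace) auto
  moreover obtain z where z: "z \<in> W" "z \<noteq> 0"
    using W subspace_0 by blast
  then have "z /\<^sub>R norm z \<in> sphere 0 1 \<inter> W"
    using W(1) by (simp add: subspace_scale)
  then have "sphere 0 1 \<inter> W \<noteq> {}" by blast
  moreover have "continuous_on (sphere 0 1 \<inter> W) R"
  proof -
    have "b v v \<noteq> 0" if "v \<in> sphere 0 1 \<inter> W" for v
      using that pos[of v] by (cases "v = 0") auto
    then show ?thesis
      unfolding R_def by (intro continuous_intros bb.continuous_on continuous_on) auto
  qed
  ultimately obtain x where x: "x \<in> sphere 0 1 \<inter> W"
    and max: "\<And>y. y \<in> sphere 0 1 \<inter> W \<Longrightarrow> R y \<le> R x"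
    using continuous_attains_sup[of "sphere 0 1 \<inter> W" R] by blast
  have x0: "x \<noteq> 0" and xW: "x \<in> W" using x by auto
  define l where "l = R x"
  define c where "c v w = l * b v w - b (f v) w" for v w
  have c_nonneg: "0 \<le> c v v" if "v \<in> W" for v
  proof (cases "v = 0")
    case True
    then show ?thesis by (simp add: c_def bb.zero_left bb.zero_right)
  next
    case False
    have "R (v /\<^sub>R norm v) \<le> l"
      using max[of "v /\<^sub>R norm v"] that False W(1) by (simp add: l_def subspace_scale)
    moreover have "R (v /\<^sub>R norm v) = R v"
      using False by (simp add: R_def scaleR bb.scaleR_left bb.scaleR_right)
    ultimately have "R v \<le> l" by simp
    then show ?thesis
      using pos[OF False] by (simp add: R_def c_def divide_le_eq)
  qed
  have c_xx: "c x x = 0"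
    using pos[OF x0] by (simp add: c_def l_def R_def)
  have c_sym: "c v w = c w v" for v w
    using sym self by (metis c_def)
  define y where "y = l *\<^sub>R x - f x"
  have yW: "y \<in> W"
    using xW W(1) inv by (simp add: y_def subspace_diff subspace_scale)
  have c_xy: "c x y = b y y"
    by (simp add: c_def y_def bb.diff_left bb.scaleR_left)
  have "y = 0"
  proof (rule ccontr)
    assume "y \<noteq> 0"
    then have B: "0 < b y y" by (rule pos)
    have C: "0 \<le> c y y" using c_nonneg yW by blast
    \<comment> \<open>Along \<open>x - t *\<^sub>R y\<close> the form \<open>c\<close> equals
      \<open>t\<^sup>2 * c y y - 2 * t * b y y\<close>, which is negative for small positive
      \<open>t\<close>. The minimizer would be \<open>b y y / c y y\<close>; the added 1 keeps the
      denominator positive when \<open>c y y = 0\<close>.\<close>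
    define t where "t = b y y / (c y y + 1)"
    have "0 \<le> c (x - t *\<^sub>R y) (x - t *\<^sub>R y)"
      using xW yW W(1) by (intro c_nonneg) (simp add: subspace_diff subspace_scale)
    also have "\<dots> = c x x - t * c x y - t * c y x + t\<^sup>2 * c y y"
      by (simp add: c_def diff scaleR bb.diff_left bb.diff_right bb.scaleR_left bb.scaleR_right
          algebra_simps power2_eq_square)
    also have "\<dots> = t\<^sup>2 * c y y - 2 * t * b y y"
      using c_xx c_xy c_sym[of y x] by simp
    also have "b y y = t * (c y y + 1)"
      using C by (simp add: t_def)
    also have "t\<^sup>2 * c y y - 2 * t * (t * (c y y + 1)) = - (t\<^sup>2 * (c y y + 2))"
      by (simp add: algebra_simps power2_eq_square)
    finally have "t\<^sup>2 * (c y y + 2) \<le> 0" by simp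
    moreover have "0 < t\<^sup>2 * (c y y + 2)"
      using B C by (simp add: t_def)
    ultimately show False by simp
  qed
  then show ?thesis
    using xW x0 by (metis eq_iff_diff_eq_0 y_def)
qed

text \<open>The orthogonal complement of all eigenvectors is invariant, so it would contain a further
  eigenvector if it were nonzero.\<close>

lemma bilinear_selfadjoint_eigenvectors_span:
  fixes b :: "'a::euclidean_space \<Rightarrow> 'a \<Rightarrow> real"
  assumes bil: "bilinear b"
    and sym: "\<And>v w. b v w = b w v"
    and pos: "\<And>v. v \<noteq> 0 \<Longrightarrow> 0 < b v v"
    and lin: "linear f"
    and self: "\<And>v w. b (f v) w = b v (f w)"
  shows "span {v. \<exists>l. f v = l *\<^sub>R v} = UNIV"
proof (rule ccontr)
  interpret bb: bounded_bilinear b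
    using bil by (simp add: bilinear_conv_bounded_bilinear)
  define E where "E = {v. \<exists>l. f v = l *\<^sub>R v}"
  assume "span {v. \<exists>l. f v = l *\<^sub>R v} \<noteq> UNIV"
  then obtain y where y: "y \<noteq> 0" "\<And>e. e \<in> E \<Longrightarrow> y \<bullet> e = 0"
    using span_not_UNIV_orthogonal span_base unfolding E_def by metis
  \<comment> \<open>\<open>G\<close> represents \<open>b\<close> through the Euclidean inner
    product. Its surjectivity turns the Euclidean normal \<open>y\<close> of the eigenvectors into a
    vector \<open>v\<close> that is \<open>b\<close>-orthogonal to them.\<close>
  define G where "G v = (\<Sum>i\<in>Basis. b v i *\<^sub>R i)" for v
  have G: "G v \<bullet> w = b v w" for v w
  proof -
    have "b v w = b v (\<Sum>i\<in>Basis. (w \<bullet> i) *\<^sub>R i)"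
      by (simp add: euclidean_representation)
    also have "\<dots> = G v \<bullet> w"
      by (simp add: G_def bb.sum_right bb.scaleR_right inner_sum_left inner_commute[of w] mult.commute)
    finally show ?thesis ..
  qed
  have "linear G"
    by (intro linearI) (auto simp: G_def bb.add_left bb.scaleR_left scaleR_left_distrib
        sum.distrib scaleR_right.sum)
  moreover have "inj G"
    using G pos by (subst linear_injective_0[OF \<open>linear G\<close>]) (metis inner_zero_left less_irrefl)
  ultimately have "surj G"
    by (rule linear_injective_imp_surjective) simp
  then obtain v where v: "y = G v" by blast
  define W where "W = {v. \<forall>e\<in>E. b v e = 0}"
  have W_sub: "subspace W"
    by (auto simp: subspace_def W_def bb.zero_left bb.add_left bb.scaleR_left)
  have W_ne: "W \<noteq> {0}"
  proof -
    have "v \<in> W" using y(2) G v by (simp add: W_def)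
    moreover have "v \<noteq> 0" using y(1) v \<open>linear G\<close> linear_0 by blast
    ultimately show ?thesis by blast
  qed
  \<comment> \<open>For an eigenvector \<open>e\<close> with eigenvalue \<open>l\<close>,
    \<open>b (f w) e = b w (f e) = l * b w e = 0\<close>.\<close>
  have W_inv: "f w \<in> W" if "w \<in> W" for w
    using that by (auto simp: W_def E_def self bb.scaleR_right)
  have "\<exists>x\<in>W. x \<noteq> 0 \<and> (\<exists>l. f x = l *\<^sub>R x)"
    by (rule bilinear_selfadjoint_eigenvector[of b])
       (fact bil sym pos lin self W_sub W_ne W_inv)+
  then obtain x l where x: "x \<in> W" "x \<noteq> 0" "f x = l *\<^sub>R x"
    by blast
  \<comment> \<open>As an eigenvector \<open>x\<close> lies in \<open>E\<close>, and as a member of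
    \<open>W\<close> it is \<open>b\<close>-orthogonal to \<open>E\<close>, hence to itself.\<close>
  then have "b x x = 0"
    by (auto simp: W_def E_def)
  then show False
    using pos[OF x(2)] by simp
qed

text \<open>A maximal independent set of eigenvectors is a basis; enumerated by the index type, it
  provides the columns of the diagonalizing matrix.\<close>

lemma real_diagonalizable_if_eigenvectors_span:
  fixes A :: "real^'n^'n"
  assumes "span {v. \<exists>l. A *v v = l *\<^sub>R v} = UNIV"
  shows "real_diagonalizable A"
proof -
  obtain B where B: "B \<subseteq> {v. \<exists>l. A *v v = l *\<^sub>R v}" "independent B"
      "{v. \<exists>l. A *v v = l *\<^sub>R v} \<subseteq> span B"
    using maximal_independent_subset[of "{v. \<exists>l. A *v v = l *\<^sub>R v}"] by blast
  have span: "span B = UNIV"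
    using assms span_minimal[OF B(3) subspace_span] by auto
  have "finite B" using B(2) by (rule independent_imp_finite)
  moreover have "card B = CARD('n)"
    using indep_card_eq_dim_span[OF B(2)] span by simp
  ultimately obtain h where h: "bij_betw h (UNIV :: 'n set) B"
    using finite_same_card_bij[of "UNIV :: 'n set" B] by auto
  have "\<exists>l. A *v h j = l *\<^sub>R h j" for j
    using h B(1) bij_betwE by blast
  then obtain l where l: "\<And>j. A *v h j = l j *\<^sub>R h j" by metis
  define V :: "real^'n^'n" where "V = (\<chi> i j. h j $ i)"
  define D :: "real^'n^'n" where "D = (\<chi> i j. if i = j then l j else 0)"
  have "columns V = B"
    using h by (auto simp: columns_def column_def V_def bij_betw_def)
  then have "invertible V"
    using span by (simp add: invertible_right_inverse matrix_right_invertible_span_columns span_vec_eq)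
  moreover have "A ** V = V ** D"
  proof -
    have "(A ** V) $ i $ j = (V ** D) $ i $ j" for i j
    proof -
      have "(A ** V) $ i $ j = (A *v h j) $ i"
        by (simp add: matrix_matrix_mult_def matrix_vector_mult_def V_def)
      also have "\<dots> = (V ** D) $ i $ j"
        by (simp add: l matrix_matrix_mult_def V_def D_def if_distrib cong: if_cong)
      finally show ?thesis .
    qed
    then show ?thesis by (simp add: vec_eq_iff)
  qed
  then have "A = V ** D ** matrix_inv V"
    using mul_matrix_inv[OF \<open>invertible V\<close>] by (metis matrix_mul_assoc matrix_mul_rid)
  ultimately show ?thesis
    unfolding real_diagonalizable_def
    by (intro exI[of _ V] exI[of _ D]) (simp add: D_def)
qed

section \<open>Differentiability of solutions of linear systems\<close>

lemma differentiable_cart_iff: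
  fixes f :: "'a::real_normed_vector \<Rightarrow> real^'n"
  shows "f differentiable (at x within S) \<longleftrightarrow> (\<forall>i. (\<lambda>y. f y $ i) differentiable (at x within S))"
  by (subst differentiable_componentwise_within)
     (auto simp: Basis_vec_def inner_axis)

lemma differentiable_det:
  fixes F :: "'a::real_normed_vector \<Rightarrow> real^'n^'n"
  assumes "\<And>i j. (\<lambda>y. F y $ i $ j) differentiable (at x within S)"
  shows "(\<lambda>y. det (F y)) differentiable (at x within S)"
proof -
  obtain D where D: "\<And>i j. ((\<lambda>y. F y $ i $ j) has_derivative D i j) (at x within S)"
    using assms unfolding differentiable_def by metis
  have "(\<lambda>y. \<Prod>i\<in>UNIV. F y $ i $ p i) differentiable (at x within S)" for p
    unfolding differentiable_def by (rule exI, rule has_derivative_prod, rule D)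
  then show ?thesis
    unfolding det_def by (intro differentiable_sum differentiable_mult ballI) auto
qed

text \<open>Cramer's rule writes the solution near \<open>x\<close> as quotients of determinants,
  which are differentiable because their entries are. This makes the velocity differentiable
  although only the state is assumed to be.\<close>

lemma differentiable_linear_solve:
  fixes H :: "'a::real_normed_vector \<Rightarrow> real^'n^'n"
  assumes H: "\<And>i j. (\<lambda>y. H y $ i $ j) differentiable (at x)"
    and r: "r differentiable (at x)"
    and ev: "\<forall>\<^sub>F y in nhds x. invertible (H y) \<and> H y *v u y = r y"
  shows "u differentiable (at x)"
proof -
  define c where "c y = (\<chi> k. det (\<chi> i j. if j = k then r y $ i else H y $ i $ j) / det (H y))" for y
  have r': "(\<lambda>y. r y $ i) differentiable (at x)" for i
    using r by (simp add: differentiable_cart_iff)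
  have "(\<lambda>y. if j = k then r y $ i else H y $ i $ j) differentiable (at x)" for i j k
    using H r' by (cases "j = k") auto
  moreover have "det (H x) \<noteq> 0"
    using eventually_nhds_x_imp_x[OF ev] by (simp add: invertible_det_nz)
  ultimately have "c differentiable (at x)"
    unfolding c_def differentiable_cart_iff
    by (auto intro!: differentiable_divide differentiable_det H)
  then obtain c' where c': "(c has_derivative c') (at x)"
    unfolding differentiable_def ..
  have eq: "c y = u y" if "invertible (H y) \<and> H y *v u y = r y" for y
  proof -
    have "det (H y) \<noteq> 0" "H y *v u y = r y"
      using that by (auto simp: invertible_det_nz)
    then show ?thesis
      unfolding c_def by (subst (asm) cramer) simp_all
  qed
  have "\<forall>\<^sub>F y in nhds x. c y = u y"
    using ev by eventually_elim (rule eq)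
  then have "(u has_derivative c') (at x)"
    by (intro has_derivative_transform_eventually[OF c'])
       (auto simp: eventually_nhds_conv_at)
  then show ?thesis
    unfolding differentiable_def by blast
qed

section \<open>Block vectors and linear maps between them\<close>

lemma h_part_vec_stack [simp]: "h_part (vec_stack a b) = a"
  by (simp add: h_part_def vec_stack_def)

lemma q_part_vec_stack [simp]: "q_part (vec_stack a b) = b"
  by (simp add: q_part_def vec_stack_def)

lemma vec_stack_parts [simp]: "vec_stack (h_part w) (q_part w) = w"
  by (simp add: h_part_def q_part_def vec_stack_def vec_eq_iff split: sum.split)

lemma vec_stack_eqI:
  assumes "h_part v = h_part w" "q_part v = q_part w"
  shows "v = w"
  using assms vec_stack_parts by metis

lemma vec_stack_inject [simp]: "vec_stack a b = vec_stack c d \<longleftrightarrow> a = c \<and> b = d"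
  using h_part_vec_stack q_part_vec_stack by metis

lemma vec_stack_add: "vec_stack a b + vec_stack c d = vec_stack (a + c) (b + d)"
  by (simp add: vec_stack_def vec_eq_iff split: sum.split)

lemma vec_stack_diff: "vec_stack a b - vec_stack c d = vec_stack (a - c) (b - d)"
  by (simp add: vec_stack_def vec_eq_iff split: sum.split)

lemma scaleR_vec_stack: "r *\<^sub>R vec_stack a b = vec_stack (r *\<^sub>R a) (r *\<^sub>R b)"
  by (simp add: vec_stack_def vec_eq_iff split: sum.split)

lemma bounded_linear_h_part: "bounded_linear h_part"
  by (simp add: linear_conv_bounded_linear[symmetric] linear_iff h_part_def vec_eq_iff)

lemma bounded_linear_q_part: "bounded_linear q_part"
  by (simp add: linear_conv_bounded_linear[symmetric] linear_iff q_part_def vec_eq_iff)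

lemma bounded_linear_vec_stack:
  assumes "bounded_linear f" "bounded_linear g"
  shows "bounded_linear (\<lambda>x. vec_stack (f x) (g x))"
proof -
  have "linear (\<lambda>x. vec_stack (fst x) (snd x))"
    by (intro linearI) (simp_all add: vec_stack_add scaleR_vec_stack)
  then have "bounded_linear (\<lambda>x. vec_stack (fst x) (snd x))"
    by (simp add: linear_conv_bounded_linear)
  from bounded_linear_compose[OF this bounded_linear_Pair[OF assms]]
  show ?thesis by simp
qed

lemma h_part_0 [simp]: "h_part 0 = 0" and q_part_0 [simp]: "q_part 0 = 0"
  by (simp_all add: h_part_def q_part_def vec_eq_iff)

lemmas block_linear_intros =
  bounded_linear_vec_stack bounded_linear_h_part bounded_linear_q_part
  bounded_linear_add bounded_linear_sub bounded_linear_const_scaleR bounded_linear_const_mult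
  bounded_linear_inner_left_comp bounded_linear_inner_right_comp
  bounded_linear_compose[OF matrix_vector_mul_bounded_linear]

lemma matrix_vector_mul_apply: "linear f \<Longrightarrow> matrix f *v x = f x"
  for f :: "real^'n \<Rightarrow> real^'m"
  using matrix_vector_mul(2) by metis

lemma pos_definite_imp_invertible: "pos_definite A \<Longrightarrow> invertible A"
  unfolding invertible_left_inverse matrix_left_invertible_ker pos_definite_def
  by (metis inner_zero_right less_irrefl)

section \<open>Partial derivatives as derivatives along coordinate lines\<close>

lemma partial_x_has_vector_derivative:
  assumes "F differentiable (at p)"
  shows "((\<lambda>y. F (y, snd p)) has_vector_derivative partial_x F p) (at (fst p))"
proof -
  have "(\<lambda>y. F (y, snd p)) differentiable (at (fst p))"
    by (rule differentiable_compose[of F "\<lambda>y. (y, snd p)"]) (use assms in simp_all)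
  then show ?thesis
    by (simp add: partial_x_def vector_derivative_works case_prod_beta)
qed

lemma partial_t_has_vector_derivative:
  assumes "F differentiable (at p)"
  shows "((\<lambda>s. F (fst p, s)) has_vector_derivative partial_t F p) (at (snd p))"
proof -
  have "(\<lambda>s. F (fst p, s)) differentiable (at (snd p))"
    by (rule differentiable_compose[of F "\<lambda>s. (fst p, s)"]) (use assms in simp_all)
  then show ?thesis
    by (simp add: partial_t_def vector_derivative_works case_prod_beta)
qed

lemma partial_x_eq:
  "((\<lambda>y. F (y, snd p)) has_vector_derivative D) (at (fst p)) \<Longrightarrow> partial_x F p = D"
  by (simp add: partial_x_def case_prod_beta vector_derivative_at)

lemma partial_t_eq:
  "((\<lambda>s. F (fst p, s)) has_vector_derivative D) (at (snd p)) \<Longrightarrow> partial_t F p = D"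
  by (simp add: partial_t_def case_prod_beta vector_derivative_at)

section \<open>The system matrix for an abstract commutative product\<close>

text \<open>Isolates the algebra of the Galerkin product. Associativity is not assumed, so
  \<open>P a\<close> and \<open>P b\<close> may fail to commute as matrices and the order of factors
  matters below.\<close>

locale commutative_product =
  fixes P :: "real^'k \<Rightarrow> real^'k^'k"
  assumes linear: "linear P"
    and commute: "P a *v b = P b *v a"
    and symmetric: "(P a *v b) \<bullet> c = b \<bullet> (P a *v c)"
begin

text \<open>Supplies the product rule with which \<open>H u = q\<close> and the flux are
  differentiated.\<close>

sublocale bounded_bilinear "\<lambda>a b. P a *v b"
proof -
  have "bilinear (\<lambda>a b. P a *v b)"
    unfolding bilinear_def
    by (auto intro!: linearI simp: linear_add[OF linear] linear_scale[OF linear]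
        matrix_vector_mult_add_rdistrib matrix_vector_right_distrib
        scaleR_matrix_vector_assoc matrix_vector_mult_scaleR)
  then show "bounded_bilinear (\<lambda>a b. P a *v b)"
    by (simp add: bilinear_conv_bounded_bilinear)
qed

definition velocity :: "real^('k + 'k) \<Rightarrow> real^'k" where
  "velocity w = matrix_inv (P (h_part w)) *v q_part w"

text \<open>The block matrix \<open>(1, 0; P u / 2, 1)\<close>, given as a linear map so that
  computations act on the two halves of a vector; \<open>matrix\<close> converts it where a matrix
  is required.\<close>

definition multiplier :: "real^('k + 'k) \<Rightarrow> real^('k + 'k) \<Rightarrow> real^('k + 'k)" where
  "multiplier w v =
     vec_stack (h_part v) (q_part v + (1/2) *\<^sub>R (P (velocity w) *v h_part v))"

text \<open>Where \<open>H\<close> is invertible, this is the Jacobian of the flux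
  \<open>(q, P q u)\<close> plus the nonconservative entry \<open>g H\<close>. The last summand is
  \<open>P q\<close> applied to the derivative of \<open>u\<close>, obtained by solving
  \<open>H u = q\<close> to first order.\<close>

definition jacobian :: "real \<Rightarrow> real^('k + 'k) \<Rightarrow> real^('k + 'k) \<Rightarrow> real^('k + 'k)" where
  "jacobian g w v =
     vec_stack (q_part v)
       (g *\<^sub>R (P (h_part w) *v h_part v) + P (velocity w) *v q_part v
        + P (q_part w) *v (matrix_inv (P (h_part w)) *v (q_part v - P (velocity w) *v h_part v)))"

lemma linear_multiplier: "linear (multiplier w)"
  unfolding multiplier_def
  by (intro bounded_linear.linear block_linear_intros)

lemma linear_jacobian: "linear (jacobian g w)"
  unfolding jacobian_def
  by (intro bounded_linear.linear block_linear_intros)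

text \<open>A block triangular matrix with identity diagonal blocks has trivial kernel: the first
  block forces the \<open>h\<close> part to vanish, then the second forces the \<open>q\<close>
  part.\<close>

lemma invertible_multiplier: "invertible (matrix (multiplier w))"
proof -
  have "v = 0" if "multiplier w v = 0" for v
  proof -
    have "h_part v = 0" "q_part v + (1/2) *\<^sub>R (P (velocity w) *v h_part v) = 0"
      using that h_part_vec_stack q_part_vec_stack unfolding multiplier_def
      by (metis h_part_0, metis q_part_0)
    then have "h_part v = h_part 0" "q_part v = q_part 0"
      by (simp_all add: zero_right)
    then show ?thesis by (rule vec_stack_eqI)
  qed
  then show ?thesis
    unfolding invertible_left_inverse matrix_left_invertible_ker
    by (simp add: matrix_vector_mul_apply linear_multiplier)
qed

lemma
  assumes "pos_definite (P a)"
  shows inv_left: "matrix_inv (P a) *v (P a *v b) = b"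
    and inv_right: "P a *v (matrix_inv (P a) *v b) = b"
  using mul_matrix_inv[of "P a"] matrix_inv_mul[of "P a"] pos_definite_imp_invertible[OF assms]
  by (simp_all add: matrix_vector_mul_assoc)

section \<open>The symmetrizing form and real diagonalizability\<close>

lemma inv_symmetric:
  assumes "pos_definite (P a)"
  shows "(matrix_inv (P a) *v b) \<bullet> c = b \<bullet> (matrix_inv (P a) *v c)"
  using symmetric inv_right[OF assms] by metis

text \<open>The form \<open>diag (g, H\<^sup>-\<^sup>1)\<close> pulled back along \<open>(h, q) \<mapsto> (h, q - P u h)\<close>.\<close>

definition energy :: "real \<Rightarrow> real^('k + 'k) \<Rightarrow> real^('k + 'k) \<Rightarrow> real^('k + 'k) \<Rightarrow> real" where
  "energy g w v v' = g * (h_part v \<bullet> h_part v')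
     + (q_part v - P (velocity w) *v h_part v)
         \<bullet> (matrix_inv (P (h_part w)) *v (q_part v' - P (velocity w) *v h_part v'))"

lemma energy_commute:
  assumes "pos_definite (P (h_part w))"
  shows "energy g w v v' = energy g w v' v"
  unfolding energy_def using inv_symmetric[OF assms] by (simp add: inner_commute)

lemma bilinear_energy: "bilinear (energy g w)"
  unfolding bilinear_def energy_def
  by (intro conjI allI bounded_linear.linear block_linear_intros)

lemma energy_pos:
  assumes pd: "pos_definite (P (h_part w))" and g: "0 < g" and v: "v \<noteq> 0"
  shows "0 < energy g w v v"
proof -
  define z where "z = q_part v - P (velocity w) *v h_part v"
  \<comment> \<open>Writing \<open>z = H y\<close> turns the inverse-weighted term into
    \<open>y \<bullet> (H *v y)\<close>, so positive definiteness of \<open>H\<close> itself can be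
    applied.\<close>
  define y where "y = matrix_inv (P (h_part w)) *v z"
  have z: "z = P (h_part w) *v y"
    by (simp add: y_def inv_right[OF pd])
  have "energy g w v v = g * (h_part v \<bullet> h_part v) + z \<bullet> y"
    by (simp add: energy_def z_def y_def)
  also have "z \<bullet> y = y \<bullet> (P (h_part w) *v y)"
    using z by (metis inner_commute)
  finally have e: "energy g w v v = g * (h_part v \<bullet> h_part v) + y \<bullet> (P (h_part w) *v y)" .
  have nn: "0 \<le> y \<bullet> (P (h_part w) *v y)"
    using pd unfolding pos_definite_def by (cases "y = 0") (auto intro: less_imp_le)
  show ?thesis
  proof (cases "h_part v = 0")
    case True
    then have "y \<noteq> 0"
      using v z z_def vec_stack_eqI[of v 0] by (auto simp: zero_right)
    then show ?thesis
      using True e pd by (simp add: pos_definite_def)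
  next
    case False
    then show ?thesis
      using e nn g by (simp add: add_pos_nonneg)
  qed
qed

text \<open>In the variables \<open>(h, z)\<close> the weights \<open>g\<close> and H^-1 match the
  off-diagonal blocks \<open>1\<close> and \<open>g H\<close> with each other; the diagonal blocks
  contribute forms given by the symmetric matrices \<open>P u\<close> and
  \<open>P q\<close>.\<close>

lemma energy_jacobian:
  assumes pd: "pos_definite (P (h_part w))"
  shows "energy g w (jacobian g w v) v' = energy g w v (jacobian g w v')"
proof -
  define u where "u = velocity w"
  define H where "H = P (h_part w)"
  define J where "J = matrix_inv H"
  define z where "z x = q_part x - P u *v h_part x" for x :: "real^('k+'k)"
  have q: "q_part x = z x + P u *v h_part x" for x
    by (simp add: z_def)
  have Js: "(J *v a) \<bullet> c = a \<bullet> (J *v c)" for a c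
    using inv_symmetric[OF pd] by (simp add: J_def H_def)
  have Hs: "(H *v a) \<bullet> c = a \<bullet> (H *v c)" for a c
    by (simp add: H_def symmetric)
  have HJ: "H *v (J *v a) = a" for a
    using inv_right[OF pd] by (simp add: J_def H_def)
  have hj: "h_part (jacobian g w x) = z x + P u *v h_part x" for x
    by (simp add: jacobian_def q)
  have zj: "z (jacobian g w x) = g *\<^sub>R (H *v h_part x) + P (q_part w) *v (J *v z x)" for x
    by (simp add: z_def jacobian_def u_def H_def J_def)
  have en: "energy g w x y = g * (h_part x \<bullet> h_part y) + z x \<bullet> (J *v z y)" for x y
    by (simp add: energy_def z_def u_def H_def J_def)
  \<comment> \<open>The cross terms are already symmetric in \<open>x\<close> and \<open>y\<close>.
    The other two become so by symmetry of \<open>P u\<close> and \<open>P (q_part w)\<close>, so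
    exchanging the arguments proves the claim.\<close>
  have *: "energy g w (jacobian g w x) y =
      g * (z x \<bullet> h_part y + h_part x \<bullet> z y + (P u *v h_part x) \<bullet> h_part y)
      + (P (q_part w) *v (J *v z x)) \<bullet> (J *v z y)" for x y
    by (simp add: en hj zj inner_simps Hs HJ algebra_simps)
  have "energy g w (jacobian g w v) v' = energy g w (jacobian g w v') v"
    unfolding *
    using symmetric[of u "h_part v" "h_part v'"]
      symmetric[of "q_part w" "J *v z v" "J *v z v'"]
    by (simp add: inner_commute algebra_simps)
  then show ?thesis
    by (simp add: energy_commute[OF pd])
qed

lemma real_diagonalizable_jacobian:
  assumes "pos_definite (P (h_part w))" "0 < g"
  shows "real_diagonalizable (matrix (jacobian g w))"
proof -
  have "span {v. \<exists>l. jacobian g w v = l *\<^sub>R v} = UNIV"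
    by (rule bilinear_selfadjoint_eigenvectors_span[of "energy g w"])
       (fact bilinear_energy energy_commute[OF assms(1)] energy_pos[OF assms] linear_jacobian
         energy_jacobian[OF assms(1)])+
  then show ?thesis
    by (intro real_diagonalizable_if_eigenvectors_span) (simp add: matrix_vector_mul_apply linear_jacobian)
qed

section \<open>Reduction of the system to quasilinear form\<close>

lemma flux_has_vector_derivative:
  assumes h: "(h has_vector_derivative h') (at x)"
    and q: "(q has_vector_derivative q') (at x)"
    and pd: "\<forall>\<^sub>F y in nhds x. pos_definite (P (h y))"
    and u: "\<And>y. u y = matrix_inv (P (h y)) *v q y"
  shows "((\<lambda>y. P (q y) *v u y) has_vector_derivative
     P q' *v u x + P (q x) *v (matrix_inv (P (h x)) *v (q' - P h' *v u x))) (at x)"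
proof -
  have ev: "\<forall>\<^sub>F y in nhds x. invertible (P (h y)) \<and> P (h y) *v u y = q y"
    using pd by eventually_elim (simp add: pos_definite_imp_invertible u inv_right)
  have "(\<lambda>y. P (h y)) differentiable (at x)"
    using h linear unfolding has_vector_derivative_def linear_conv_bounded_linear
    by (metis differentiable_def bounded_linear.has_derivative)
  then obtain D where D: "((\<lambda>y. P (h y)) has_derivative D) (at x)"
    unfolding differentiable_def by blast
  have "(\<lambda>y. P (h y) $ i $ j) differentiable (at x)" for i j
    using bounded_linear.has_derivative[OF bounded_linear_vec_nth[of j]
        bounded_linear.has_derivative[OF bounded_linear_vec_nth[of i] D]]
    unfolding differentiable_def by blast
  moreover have "q differentiable (at x)"
    using q differentiableI_vector by blast
  ultimately have "u differentiable (at x)"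
    using ev by (rule differentiable_linear_solve)
  then obtain u' where u': "(u has_vector_derivative u') (at x)"
    using vector_derivative_works by blast
  \<comment> \<open>The function \<open>H u\<close> is differentiated twice, here by the product
    rule and next as \<open>q\<close>, with which it agrees near \<open>x\<close>. Uniqueness of
    derivatives then determines \<open>u'\<close>.\<close>
  have "((\<lambda>y. P (h y) *v u y) has_vector_derivative (P (h x) *v u' + P h' *v u x)) (at x)"
    by (rule has_vector_derivative[OF h u'])
  moreover have "((\<lambda>y. P (h y) *v u y) has_vector_derivative q') (at x)"
  proof -
    have "\<forall>\<^sub>F y in nhds x. q y = P (h y) *v u y"
      using ev by eventually_elim simp
    then show ?thesis
      using q by (subst has_vector_derivative_cong_ev[symmetric]) (auto dest: eventually_nhds_x_imp_x)
  qed
  ultimately have "P (h x) *v u' + P h' *v u x = q'"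
    by (rule vector_derivative_unique_at)
  then have "u' = matrix_inv (P (h x)) *v (q' - P h' *v u x)"
    using inv_left eventually_nhds_x_imp_x[OF pd] by (metis add_diff_cancel_right')
  then show ?thesis
    using has_vector_derivative[OF q u'] by (simp add: add.commute)
qed

lemma multiplier_sg_swe:
  assumes D: "open D" "p \<in> D"
    and U: "U differentiable (at p)"
    and B: "B differentiable (at (fst p))"
    and pd: "\<And>p. p \<in> D \<Longrightarrow> pos_definite (P (h_part (U p)))"
  shows "multiplier (U p) (sg_swe g P B U p) =
    partial_t U p + jacobian g (U p) (partial_x U p)
      - vec_stack 0 (- g *\<^sub>R (P (h_part (U p)) *v vector_derivative B (at (fst p))))"
proof -
  define u where "u p = matrix_inv (P (h_part (U p))) *v q_part (U p)" for p
  note Ux = partial_x_has_vector_derivative[OF U]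
  note Ut = partial_t_has_vector_derivative[OF U]
  note hx = bounded_linear.has_vector_derivative[OF bounded_linear_h_part Ux]
  note qx = bounded_linear.has_vector_derivative[OF bounded_linear_q_part Ux]
  have h_t: "partial_t (\<lambda>p. h_part (U p)) p = h_part (partial_t U p)"
    by (rule partial_t_eq) (rule bounded_linear.has_vector_derivative[OF bounded_linear_h_part Ut])
  have q_t: "partial_t (\<lambda>p. q_part (U p)) p = q_part (partial_t U p)"
    by (rule partial_t_eq) (rule bounded_linear.has_vector_derivative[OF bounded_linear_q_part Ut])
  have q_x: "partial_x (\<lambda>p. q_part (U p)) p = q_part (partial_x U p)"
    by (rule partial_x_eq) (rule qx)
  have hB_x: "partial_x (\<lambda>p. h_part (U p) + B (fst p)) p
      = h_part (partial_x U p) + vector_derivative B (at (fst p))"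
    using has_vector_derivative_add[OF hx] B
    by (intro partial_x_eq) (simp add: vector_derivative_works)
  \<comment> \<open>Openness of \<open>D\<close> keeps nearby points of the line in the
    \<open>x\<close> direction inside \<open>D\<close>, so positive definiteness holds around
    \<open>p\<close>, as differentiating the velocity requires.\<close>
  have "\<forall>\<^sub>F y in nhds (fst p). (y, snd p) \<in> D"
  proof -
    have "((\<lambda>y. (y, snd p)) \<longlongrightarrow> (fst p, snd p)) (nhds (fst p))"
      by (intro tendsto_Pair filterlim_ident tendsto_const)
    then have "filterlim (\<lambda>y. (y, snd p)) (nhds p) (nhds (fst p))"
      by simp
    then show ?thesis
      using D eventually_nhds_in_open eventually_compose_filterlim by blast
  qed
  then have "\<forall>\<^sub>F y in nhds (fst p). pos_definite (P (h_part (U (y, snd p))))"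
    by eventually_elim (rule pd)
  note flux = flux_has_vector_derivative[OF hx qx this, of "\<lambda>y. u (y, snd p)"]
  have flux_x: "partial_x (\<lambda>p. P (q_part (U p)) *v u p) p =
      P (q_part (partial_x U p)) *v u p + P (q_part (U p)) *v
        (matrix_inv (P (h_part (U p))) *v (q_part (partial_x U p) - P (h_part (partial_x U p)) *v u p))"
    using flux by (intro partial_x_eq) (simp add: u_def)
  have vel: "velocity (U p) = u p"
    by (simp add: velocity_def u_def)
  have "sg_swe g P B U p = vec_stack
     (h_part (partial_t U p) + q_part (partial_x U p))
     (q_part (partial_t U p) + (P (q_part (partial_x U p)) *v u p + P (q_part (U p)) *v
        (matrix_inv (P (h_part (U p))) *v (q_part (partial_x U p) - P (h_part (partial_x U p)) *v u p)))
       + g *\<^sub>R (P (h_part (U p)) *v (h_part (partial_x U p) + vector_derivative B (at (fst p))))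
       - (1/2) *\<^sub>R (P (h_part (partial_t U p)) *v u p)
       - (1/2) *\<^sub>R (P (q_part (partial_x U p)) *v u p))"
    unfolding sg_swe_def Let_def u_def[symmetric] h_t q_t q_x hB_x flux_x ..
  \<comment> \<open>Commutativity moves \<open>u p\<close> into the matrix slot. The multiplier then
    adds half of \<open>P u\<close> applied to \<open>h_t + q_x\<close>, exactly cancelling the two
    subtracted terms.\<close>
  then have "multiplier (U p) (sg_swe g P B U p) = vec_stack
     (h_part (partial_t U p) + q_part (partial_x U p))
     (q_part (partial_t U p) + (P (u p) *v q_part (partial_x U p) + P (q_part (U p)) *v
        (matrix_inv (P (h_part (U p))) *v (q_part (partial_x U p) - P (u p) *v h_part (partial_x U p))))
       + g *\<^sub>R (P (h_part (U p)) *v (h_part (partial_x U p) + vector_derivative B (at (fst p)))))"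
    by (simp add: multiplier_def vel commute[of _ "u p"] add_right scaleR_add_right)
  also have "\<dots> = vec_stack (h_part (partial_t U p)) (q_part (partial_t U p))
      + jacobian g (U p) (partial_x U p)
      - vec_stack 0 (- g *\<^sub>R (P (h_part (U p)) *v vector_derivative B (at (fst p))))"
    by (simp add: jacobian_def vel vec_stack_add vec_stack_diff add_right scaleR_add_right
        del: vec_stack_parts)
  finally show ?thesis by simp
qed

text \<open>The source witness carries the bottom slope, with a minus sign because the quasilinear
  residual subtracts it.\<close>

lemma hyperbolic_sg_swe:
  assumes "0 < g"
  shows "hyperbolic_system (sg_swe g P) {w. pos_definite (P (h_part w))}"
  unfolding hyperbolic_system_def
  by (rule exI[of _ "\<lambda>w. matrix (multiplier w)"],
      rule exI[of _ "\<lambda>w. matrix (jacobian g w)"],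
      rule exI[of _ "\<lambda>w b. vec_stack 0 (- g *\<^sub>R (P (h_part w) *v b))"])
     (auto simp del: scaleR_minus_left
       simp add: assms invertible_multiplier real_diagonalizable_jacobian matrix_vector_mul_apply
         linear_multiplier linear_jacobian
       intro!: multiplier_sg_swe)

end

section \<open>The Galerkin matrices as a commutative product\<close>

lemma galerkin_mat_nth:
  "galerkin_mat \<rho> \<psi> z $ l $ m = (\<Sum>k\<in>UNIV. z $ k * inner_rho \<rho> (\<psi> k) (\<lambda>s. \<psi> l s * \<psi> m s))"
  by (simp add: galerkin_mat_def triple_mat_def)

text \<open>The integrand of a triple product is invariant under all permutations of its three
  indices: exchanging \<open>k\<close> and \<open>m\<close> gives commutativity, exchanging
  \<open>l\<close> and \<open>m\<close> gives symmetry of the matrices.\<close>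

lemma commutative_product_galerkin_mat:
  fixes \<psi> :: "'k::finite \<Rightarrow> real^'d \<Rightarrow> real"
  shows "commutative_product (galerkin_mat \<rho> \<psi>)"
proof (rule commutative_product.intro)
  fix a b c :: "real^'k"
  show "linear (galerkin_mat \<rho> \<psi>)"
    by (intro linearI)
       (simp_all add: galerkin_mat_def scaleR_add_left sum.distrib scaleR_right.sum)
  have T: "inner_rho \<rho> (\<psi> k) (\<lambda>s. \<psi> l s * \<psi> m s) = inner_rho \<rho> (\<psi> m) (\<lambda>s. \<psi> l s * \<psi> k s)" for k l m
    by (simp add: inner_rho_def mult_ac)
  have "(galerkin_mat \<rho> \<psi> a *v b) $ l = (galerkin_mat \<rho> \<psi> b *v a) $ l" for l
  proof -
    have "(galerkin_mat \<rho> \<psi> a *v b) $ l =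
        (\<Sum>m\<in>UNIV. \<Sum>k\<in>UNIV. a $ k * inner_rho \<rho> (\<psi> k) (\<lambda>s. \<psi> l s * \<psi> m s) * b $ m)"
      by (simp add: matrix_vector_mult_def galerkin_mat_nth sum_distrib_right)
    also have "\<dots> = (\<Sum>k\<in>UNIV. \<Sum>m\<in>UNIV. b $ m * inner_rho \<rho> (\<psi> m) (\<lambda>s. \<psi> l s * \<psi> k s) * a $ k)"
      by (subst sum.swap, intro sum.cong refl, subst T) (simp add: mult_ac)
    also have "\<dots> = (galerkin_mat \<rho> \<psi> b *v a) $ l"
      by (simp add: matrix_vector_mult_def galerkin_mat_nth sum_distrib_right)
    finally show ?thesis .
  qed
  then show "galerkin_mat \<rho> \<psi> a *v b = galerkin_mat \<rho> \<psi> b *v a"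
    by (simp add: vec_eq_iff)
  have "transpose (galerkin_mat \<rho> \<psi> a) = galerkin_mat \<rho> \<psi> a"
    by (simp add: transpose_def vec_eq_iff galerkin_mat_nth mult.commute)
  then show "(galerkin_mat \<rho> \<psi> a *v b) \<bullet> c = b \<bullet> (galerkin_mat \<rho> \<psi> a *v c)"
    by (metis dot_lmul_matrix transpose_matrix_vector)
qed

text \<open>The finite type \<open>'k\<close> serves as the index set of the vectors, and \<iota>
  numbers its elements from 1 to \<open>K\<close>. Positive definiteness at every space-time point
  is expressed by the admissible set of states.\<close>

theorem theorem2:
  fixes \<rho> :: "real^'d \<Rightarrow> real"
    and \<phi> :: "nat \<Rightarrow> real^'d \<Rightarrow> real"
    and K :: nat
    and \<iota> :: "'k::finite \<Rightarrow> nat"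
    and g :: real
  assumes "prob_density \<rho>"
    and "finite_moments \<rho>"
    and "\<And>k. k \<ge> 1 \<Longrightarrow> real_polynomial_function (\<phi> k)"
    and "\<phi> 1 = (\<lambda>s. 1)"
    and "\<And>j k. j \<ge> 1 \<Longrightarrow> k \<ge> 1 \<Longrightarrow> inner_rho \<rho> (\<phi> j) (\<phi> k) = (if j = k then 1 else 0)"
    and "bij_betw \<iota> (UNIV :: 'k set) {1..K}"
    and "g > 0"
  shows "hyperbolic_system (sg_swe g (galerkin_mat \<rho> (\<lambda>i. \<phi> (\<iota> i))))
           {w. pos_definite (galerkin_mat \<rho> (\<lambda>i. \<phi> (\<iota> i)) (h_part w))}"
  using commutative_product_galerkin_mat assms(7)
  by (rule commutative_product.hyperbolic_sg_swe)

end
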